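(* Suppose single-shot SBFT, with fast-path timeout function $F_f$, is run with a synchronizer satisfying the specification (P1)-(P5) given in the context for a view $\mathcal V$ and $d=2\delta$. Let $v\ge\mathcal V$ be a view such that $F_f(v)>2\delta$, $F(v)-F_f(v)>5\delta$ (so that $F(v)>7\delta$) and $\mathsf{leader}(v)$ is correct. Then all correct processes decide at $v$ by time $E_{\rm last}(v)+F_f(v)+3\delta$.
   Context: Model. There are $n=3f+1$ processes $\mathcal P=\{p_1,\dots,p_n\}$, at most $f$ of which are faulty (Byzantine, behaving arbitrarily); the others are correct. A quorum is a set of $2f+1$ processes. Processes communicate over authenticated point-to-point links. Partial synchrony: there are a time $\mathsf{GST}$ and a bound $\delta$, both unknown to the protocol, such that after $\mathsf{GST}$ messages between correct processes are delayed by at most $\delta$; before $\mathsf{GST}$ messages may be arbitrarily delayed or lost (self-addressed messages are never lost). Local clocks may drift unboundedly before $\mathsf{GST}$ and do not drift from real time after it. Local processing takes zero time. $\langle m\rangle_i$ denotes $m$ signed by $p_i$; signatures are unforgeable and $\mathsf{hash}$ is collision-resistant (both idealized as perfect). Each correct process has a proposal $\mathtt{myval}()$ satisfying a given predicate $\mathsf{valid}$. Synchronizer. Views are $1,2,\dots$; $0$ denotes an invalid view. A synchronizer issues notifications $\mathtt{new\_view}(v)$ at each correct process, which then enters $v$ and stays in it until it enters another view. Each correct process eventually calls the synchronizer's function $\mathtt{start}()$. The timeout function $F:\{0,1,2,\dots\}\to\mathsf{Time}$ is monotone, $F(0)=0$, and for every $\theta$ there is $v$ with $F(v')>\theta$ for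 all $v'\ge v$. $E_i(v)$ is the time when correct $p_i$ enters $v$; $E_{\rm first}(v)$, $E_{\rm last}(v)$ are the earliest and latest times when some correct process enters $v$. Specification, for a view $\mathcal V$: (P1) if $v<v'$ and $E_i(v),E_i(v')$ are defined then $E_i(v)<E_i(v')$; (P2) $E_{\rm first}(\mathcal V)\ge\mathsf{GST}$; (P3) every correct process enters every $v\ge\mathcal V$; (P4) $E_{\rm last}(v)\le E_{\rm first}(v)+d$ for all $v\ge\mathcal V$; (P5) $E_{\rm first}(v+1)\ge E_{\rm first}(v)+F(v)$ for all $v\ge\mathcal V$. Single-shot (all-to-all) SBFT (code of $p_i$), with fast-path timeout function $F_f$. $\mathsf{leader}(v)=p_{((v-1)\bmod n)+1}$. Variables $\mathsf{curr\_view},\mathsf{locked\_view},\mathsf{pre\_view}$ are initially $0$; $\mathsf{curr\_val},\mathsf{prepared\_val},\mathsf{cert},\mathsf{voted}$ are initially $\bot$; $\mathsf{timer\_fast\_path}$ is a timer. A handler runs when its trigger and precondition hold; messages for views higher than the current one are buffered (for each type and sender, only the one with the highest view is kept). "All" includes the sender. 1. Upon $\mathtt{new\_view}(v)$: $\mathsf{curr\_view}:=v$; $\mathsf{voted}:=$ false; send $\langle\mathtt{NEWLEADER}(v,\mathsf{locked\_view},\mathsf{prepared\_val},\mathsf{cert},\mathsf{pre\_view},\mathsf{curr\_val})\rangle_i$ to $\mathsf{leader}(v)$. 2. (Once per view.) When messages $M=\{\langle\mathtt{NEWLEADER}(v,view_j,val_j,cert_j,pre_j,cur_j)\rangle_j\mid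 p_j\in Q\}$ are received for a quorum $Q$, with $\mathsf{curr\_view}=v$, $p_i=\mathsf{leader}(v)$ and ValidNewLeader$(m)$ for all $m\in M$: compute $(x_{\rm slow},v_{\rm slow},x_{\rm fast},v_{\rm fast})$ by the Selection rule below; if $v_{\rm slow}\ge v_{\rm fast}$ and $v_{\rm slow}>0$, send $\langle\mathtt{PROPOSE}(v,x_{\rm slow},M)\rangle_i$ to all; else if $v_{\rm fast}>v_{\rm slow}$, send $\langle\mathtt{PROPOSE}(v,x_{\rm fast},M)\rangle_i$ to all; else send $\langle\mathtt{PROPOSE}(v,\mathtt{myval}(),M)\rangle_i$ to all. 3. When $m=\langle\mathtt{PROPOSE}(v,x,\_)\rangle_j$ is received, with $\mathsf{curr\_view}=v$, $\mathsf{voted}=$ false, SafeProposal$(m)$: $\mathsf{curr\_val}:=x$; $\mathsf{pre\_view}:=v$; $\mathsf{voted}:=$ true; stop $\mathsf{timer\_fast\_path}$ and start it with duration $F_f(v)$; send $\langle\mathtt{PREPARED}(v,\mathsf{hash}(x))\rangle_i$ to all. 4. (Fast path.) When $\{\langle\mathtt{PREPARED}(v,h)\rangle_j\mid p_j\in\mathcal P\}$ (from all processes) is received, with $\mathsf{curr\_view}=v$, $\mathsf{voted}=$ true, $\mathsf{hash}(\mathsf{curr\_val})=h$: decide $\mathsf{curr\_val}$. 5. When $\mathsf{timer\_fast\_path}$ has expired and $C=\{\langle\mathtt{PREPARED}(v,h)\rangle_j\mid p_j\in Q\}$ has been received for at least a quorum $Q$, with $\mathsf{curr\_view}=v$, $\mathsf{voted}=$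 true, $\mathsf{hash}(\mathsf{curr\_val})=h$: $\mathsf{prepared\_val}:=\mathsf{curr\_val}$; $\mathsf{locked\_view}:=v$; $\mathsf{cert}:=C$; send $\langle\mathtt{COMMITTED}(v,h)\rangle_i$ to all. 6. When $\{\langle\mathtt{COMMITTED}(v,h)\rangle_j\mid p_j\in Q\}$ is received for a quorum $Q$, with $\mathsf{curr\_view}=\mathsf{locked\_view}=v$, $\mathsf{hash}(\mathsf{curr\_val})=h$: decide $\mathsf{curr\_val}$. Selection rule. $(x_{\rm slow},v_{\rm slow})=(val_j,view_j)$ for some $j$ with $view_j=\max\{view_k\mid p_k\in Q\}$ if this maximum is nonzero, else $(\bot,0)$. Let $D$ be the set of pairs $(x,u)$ for which there is $P\subseteq Q$ with $|P|=f+1$, $cur_j=x$ for all $p_j\in P$, and $u=\min\{pre_j\mid p_j\in P\}$. Let $u^*=\max\{u\mid(\_,u)\in D\}$; if there is exactly one $x$ with $(x,u^* )\in D$, then $(x_{\rm fast},v_{\rm fast})=(x,u^* )$; otherwise (including $D=\emptyset$) $(x_{\rm fast},v_{\rm fast})=(\bot,0)$. View-1 optimization: in view $1$ the leader proposes $\mathtt{myval}()$ immediately on entering, without waiting for $\mathtt{NEWLEADER}$ messages (which need not be sent to it), and SafeProposal for view $1$ only requires that the sender is $\mathsf{leader}(1)$ and the value is valid. Predicates: prepared$(C,v,h)$ iff $C=\{\langle\mathtt{PREPARED}(v,h)\rangle_j\mid p_j\in Q\}$ for some quorum $Q$ (a certificate with more than $2f+1$ messages is also accepted). ValidNewLeader$(\langle\mathtt{NEWLEADER}(v',v,x,C,v_0,x_0)\rangle_{\_})$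 iff $v\le v_0<v'$ and ($v\ne0$ implies prepared$(C,v,\mathsf{hash}(x))$). SafeProposal$(\langle\mathtt{PROPOSE}(v,x,M)\rangle_i)$ iff $p_i=\mathsf{leader}(v)$, $\mathsf{valid}(x)$, $M$ is a set of $\mathtt{NEWLEADER}$ messages for view $v$ signed by the members of some quorum $Q$, all satisfying ValidNewLeader, and for $v_{\rm slow},v_{\rm fast},x_{\rm slow},x_{\rm fast}$ computed from $M$ by the Selection rule: ($v_{\rm slow}\ge v_{\rm fast}$ and $v_{\rm slow}>0$ imply $x=x_{\rm slow}$) and ($v_{\rm slow}<v_{\rm fast}$ implies $x=x_{\rm fast}$). *)

theory Defs
  imports Complex_Main
begin

type_synonym proc = nat
type_synonym view = nat
type_synonym time = real

text \<open>
  Processes are the numbers \<open>1, \<dots>, 3 * f + 1\<close>. Every message carries its signer as the last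
  component. The value \<open>\<bottom>\<close> is rendered by \<^const>\<open>None\<close>.
\<close>

datatype 'h prepared = Prepared (p_view: view) (p_hash: 'h) (p_signer: proc)

datatype ('v, 'h) newleader =
  NewLeader (nl_view: view) (nl_locked: view) (nl_val: "'v option")
    (nl_cert: "'h prepared set option") (nl_pre: view) (nl_cur: "'v option") (nl_signer: proc)

datatype ('v, 'h) msg =
    MNewLeader "('v, 'h) newleader"
  | MPropose view "'v option" "('v, 'h) newleader set" proc
  | MPrepared "'h prepared"
  | MCommitted view 'h proc

fun msg_view :: "('v, 'h) msg \<Rightarrow> view" where
  "msg_view (MNewLeader m) = nl_view m"
| "msg_view (MPropose v x M j) = v"
| "msg_view (MPrepared m) = p_view m"
| "msg_view (MCommitted v h j) = v"

fun msg_signer :: "('v, 'h) msg \<Rightarrow> proc" where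
  "msg_signer (MNewLeader m) = nl_signer m"
| "msg_signer (MPropose v x M j) = j"
| "msg_signer (MPrepared m) = p_signer m"
| "msg_signer (MCommitted v h j) = j"

fun same_type :: "('v, 'h) msg \<Rightarrow> ('v, 'h) msg \<Rightarrow> bool" where
  "same_type (MNewLeader _) (MNewLeader _) = True"
| "same_type (MPropose _ _ _ _) (MPropose _ _ _ _) = True"
| "same_type (MPrepared _) (MPrepared _) = True"
| "same_type (MCommitted _ _ _) (MCommitted _ _ _) = True"
| "same_type _ _ = False"

text \<open>All signed messages occurring in a message, including the message itself.\<close>

fun newleader_parts :: "('v, 'h) newleader \<Rightarrow> ('v, 'h) msg set" where
  "newleader_parts m =
     insert (MNewLeader m) (case nl_cert m of None \<Rightarrow> {} | Some C \<Rightarrow> MPrepared ` C)"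

fun msg_parts :: "('v, 'h) msg \<Rightarrow> ('v, 'h) msg set" where
  "msg_parts (MNewLeader m) = newleader_parts m"
| "msg_parts (MPropose v x M j) = insert (MPropose v x M j) (\<Union>m\<in>M. newleader_parts m)"
| "msg_parts m = {m}"

text \<open>
  The handlers other than the one for \<open>new_view\<close>: leader's proposal, acceptance of a proposal,
  fast-path decision, locking after expiry of the fast-path timer, slow-path decision.
\<close>

datatype handler = HPropose | HAccept | HFastDecide | HLock | HDecide

datatype ('v, 'h) action =
    Start
  | NewView view
  | Recv proc "('v, 'h) msg"  \<comment> \<open>receipt of a message over the link from the given process\<close>
  | Run handler

text \<open>
  Local state of a correct process. Field \<open>timer\<close> is the deadline of the fast-path timer on the
  local clock (\<^const>\<open>None\<close>: never started). Field \<open>inbox\<close> contains the messages available to the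
  handlers or buffered for later views. Field \<open>ran\<close> is bookkeeping: the handlers already run
  in the current view.
\<close>

record ('v, 'h) lstate =
  curr_view :: view
  locked_view :: view
  pre_view :: view
  curr_val :: "'v option"
  prepared_val :: "'v option"
  cert :: "'h prepared set option"
  voted :: "bool option"
  timer :: "time option"
  inbox :: "('v, 'h) msg set"
  ran :: "handler set"

definition init_state :: "('v, 'h) lstate" where
  "init_state = \<lparr>curr_view = 0, locked_view = 0, pre_view = 0, curr_val = None,
     prepared_val = None, cert = None, voted = None, timer = None, inbox = {}, ran = {}\<rparr>"

text \<open>
  Possible effects of receiving \<open>m\<close>. Messages for past views are ignored and all messages
  for the current view are kept. Among the messages for future views, only one of highest view is
  kept for each type and signer; if two different ones tie, either may be kept.
\<close>

inductive buffer :: "('v, 'h) msg \<Rightarrow> ('v, 'h) lstate \<Rightarrow> ('v, 'h) lstate \<Rightarrow> bool" where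
  past: "msg_view m < curr_view s \<Longrightarrow> buffer m s s"
| current: "msg_view m = curr_view s \<Longrightarrow> buffer m s (s\<lparr>inbox := insert m (inbox s)\<rparr>)"
| store: "\<lbrakk>curr_view s < msg_view m;
     Rivals = {r \<in> inbox s. same_type r m \<and> msg_signer r = msg_signer m \<and> curr_view s < msg_view r};
     \<forall>r\<in>Rivals. msg_view r \<le> msg_view m\<rbrakk>
   \<Longrightarrow> buffer m s (s\<lparr>inbox := insert m (inbox s - Rivals)\<rparr>)"
| discard: "\<lbrakk>curr_view s < msg_view m; r \<in> inbox s; same_type r m; msg_signer r = msg_signer m;
     msg_view m \<le> msg_view r\<rbrakk>
   \<Longrightarrow> buffer m s s"

locale sbft =
  fixes f :: nat
    and valid :: "'v \<Rightarrow> bool"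
    and hash :: "'v \<Rightarrow> 'h"
    and myval :: "proc \<Rightarrow> 'v"
    and Ff :: "view \<Rightarrow> time"
begin

definition procs :: "proc set" where
  "procs = {1..3 * f + 1}"

definition quorum :: "proc set \<Rightarrow> bool" where
  "quorum Q \<longleftrightarrow> Q \<subseteq> procs \<and> card Q = 2 * f + 1"

definition leader :: "view \<Rightarrow> proc" where
  "leader v = (v - 1) mod (3 * f + 1) + 1"

definition prepared :: "'h prepared set \<Rightarrow> view \<Rightarrow> 'h \<Rightarrow> bool" where
  "prepared C v h \<longleftrightarrow>
     (\<exists>Q \<subseteq> procs. card Q \<ge> 2 * f + 1 \<and> C = {Prepared v h j | j. j \<in> Q})"

text \<open>No hash value is the hash of \<open>\<bottom>\<close>.\<close>

definition valid_newleader :: "('v, 'h) newleader \<Rightarrow> bool" where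
  "valid_newleader m \<longleftrightarrow>
     nl_locked m \<le> nl_pre m \<and> nl_pre m < nl_view m \<and>
     (nl_locked m \<noteq> 0 \<longrightarrow>
        (\<exists>C x. nl_cert m = Some C \<and> nl_val m = Some x \<and> prepared C (nl_locked m) (hash x)))"

text \<open>
  Set \<open>M\<close> consists of messages \<open>NEWLEADER\<close> for view \<open>v\<close>, one from each member of some quorum, all
  of them valid. Subsets of the quorum then correspond to subsets of \<open>M\<close>; the selection rule below
  is expressed with the latter.
\<close>

definition newleader_quorum :: "view \<Rightarrow> ('v, 'h) newleader set \<Rightarrow> bool" where
  "newleader_quorum v M \<longleftrightarrow>
     (\<exists>Q. quorum Q \<and> bij_betw nl_signer M Q) \<and> (\<forall>m\<in>M. nl_view m = v \<and> valid_newleader m)"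

text \<open>
  The slow choice is a relation since the rule allows any message with the maximal locked view.
\<close>

definition slow_choice :: "('v, 'h) newleader set \<Rightarrow> 'v option \<Rightarrow> view \<Rightarrow> bool" where
  "slow_choice M x v \<longleftrightarrow>
     (if Max (nl_locked ` M) \<noteq> 0
      then \<exists>m\<in>M. nl_locked m = Max (nl_locked ` M) \<and> x = nl_val m \<and> v = nl_locked m
      else x = None \<and> v = 0)"

definition fast_candidates :: "('v, 'h) newleader set \<Rightarrow> ('v option \<times> view) set" where
  "fast_candidates M =
     {(x, u). \<exists>P \<subseteq> M. card P = f + 1 \<and> (\<forall>m\<in>P. nl_cur m = x) \<and> u = Min (nl_pre ` P)}"

definition fast_choice :: "('v, 'h) newleader set \<Rightarrow> 'v option \<times> view" where
  "fast_choice M =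
     (let D = fast_candidates M; u = Max (snd ` D) in
      if D \<noteq> {} \<and> (\<exists>!x. (x, u) \<in> D) then (THE x. (x, u) \<in> D, u) else (None, 0))"

definition safe_proposal ::
    "view \<Rightarrow> 'v option \<Rightarrow> ('v, 'h) newleader set \<Rightarrow> proc \<Rightarrow> bool" where
  "safe_proposal v x M j \<longleftrightarrow>
     j = leader v \<and> (\<exists>y. x = Some y \<and> valid y) \<and>
     (v \<noteq> 1 \<longrightarrow>
        newleader_quorum v M \<and>
        (\<exists>xs vs xf vf. slow_choice M xs vs \<and> fast_choice M = (xf, vf) \<and>
           (vs \<ge> vf \<and> vs > 0 \<longrightarrow> x = xs) \<and> (vs < vf \<longrightarrow> x = xf)))"

text \<open>
  \<open>step i c s a s' out d\<close>: process \<open>i\<close>, whose local clock shows \<open>c\<close>, performs \<open>a\<close> in state \<open>s\<close>,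
  moves to \<open>s'\<close>, sends the messages in \<open>out\<close> (pairs of destination and message) and decides \<open>d\<close>,
  if any. In view \<open>1\<close> no \<open>NEWLEADER\<close> messages are needed; sending them is optional.
\<close>

inductive step ::
    "proc \<Rightarrow> time \<Rightarrow> ('v, 'h) lstate \<Rightarrow> ('v, 'h) action \<Rightarrow> ('v, 'h) lstate \<Rightarrow>
     (proc \<times> ('v, 'h) msg) set \<Rightarrow> 'v option \<Rightarrow> bool"
  for i :: proc and c :: time and s :: "('v, 'h) lstate" where
  start: "step i c s Start s {} None"
| new_view:
    "\<lbrakk>v \<ge> 1;
      nl = {(leader v, MNewLeader (NewLeader v (locked_view s) (prepared_val s) (cert s)
                                     (pre_view s) (curr_val s) i))};
      out_nl = nl \<or> v = 1 \<and> out_nl = {};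
      out_prop = (if v = 1 \<and> i = leader 1 then procs \<times> {MPropose 1 (Some (myval i)) {} i} else {})\<rbrakk>
     \<Longrightarrow> step i c s (NewView v) (s\<lparr>curr_view := v, voted := Some False, ran := {}\<rparr>)
           (out_nl \<union> out_prop) None"
| recv: "buffer m s s' \<Longrightarrow> step i c s (Recv j m) s' {} None"
| propose:
    "\<lbrakk>curr_view s = v; i = leader v; v \<noteq> 1; HPropose \<notin> ran s;
      MNewLeader ` M \<subseteq> inbox s; newleader_quorum v M;
      slow_choice M xs vs; fast_choice M = (xf, vf);
      x = (if vs \<ge> vf \<and> vs > 0 then xs else if vf > vs then xf else Some (myval i))\<rbrakk>
     \<Longrightarrow> step i c s (Run HPropose) (s\<lparr>ran := insert HPropose (ran s)\<rparr>)
           (procs \<times> {MPropose v x M i}) None"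
| accept:
    "\<lbrakk>MPropose v x M j \<in> inbox s; curr_view s = v; voted s = Some False; safe_proposal v x M j;
      x = Some y\<rbrakk>
     \<Longrightarrow> step i c s (Run HAccept)
           (s\<lparr>curr_val := x, pre_view := v, voted := Some True, timer := Some (c + Ff v),
              ran := insert HAccept (ran s)\<rparr>)
           (procs \<times> {MPrepared (Prepared v (hash y) i)}) None"
| fast_decide:
    "\<lbrakk>curr_view s = v; voted s = Some True; curr_val s = Some x;
      \<forall>j\<in>procs. MPrepared (Prepared v (hash x) j) \<in> inbox s\<rbrakk>
     \<Longrightarrow> step i c s (Run HFastDecide) (s\<lparr>ran := insert HFastDecide (ran s)\<rparr>) {} (Some x)"
| lock:
    "\<lbrakk>timer s = Some deadline; deadline \<le> c;
      curr_view s = v; voted s = Some True; curr_val s = Some x;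
      MPrepared ` C \<subseteq> inbox s; prepared C v (hash x)\<rbrakk>
     \<Longrightarrow> step i c s (Run HLock)
           (s\<lparr>prepared_val := curr_val s, locked_view := v, cert := Some C,
              ran := insert HLock (ran s)\<rparr>)
           (procs \<times> {MCommitted v (hash x) i}) None"
| decide:
    "\<lbrakk>curr_view s = v; locked_view s = v; curr_val s = Some x; quorum Q;
      \<forall>j\<in>Q. MCommitted v (hash x) j \<in> inbox s\<rbrakk>
     \<Longrightarrow> step i c s (Run HDecide) (s\<lparr>ran := insert HDecide (ran s)\<rparr>) {} (Some x)"

text \<open>
  A handler is pending if it can run but has not yet run in the current view. Repeated runs of the
  locking and deciding handlers within a view are possible but not required.
\<close>

definition pending :: "proc \<Rightarrow> time \<Rightarrow> ('v, 'h) lstate \<Rightarrow> handler \<Rightarrow> bool" where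
  "pending i c s h \<longleftrightarrow> h \<notin> ran s \<and> (\<exists>s' out d. step i c s (Run h) s' out d)"

end

text \<open>
  An execution is an infinite sequence of steps of correct processes, faulty ones being visible only
  through the messages received from them. Step \<open>k\<close> is action \<open>act k\<close> of process \<open>who k\<close> at real time
  \<open>tm k\<close>; it sends the messages \<open>sent k\<close> and decides \<open>decision k\<close>. Process \<open>i\<close> is in state \<open>st k i\<close> just before
  step \<open>k\<close>, and \<open>clock i t\<close> is what its local clock shows at real time \<open>t\<close>.
\<close>

record ('v, 'h) execution =
  correct :: "proc set"
  clock :: "proc \<Rightarrow> time \<Rightarrow> time"
  who :: "nat \<Rightarrow> proc"
  act :: "nat \<Rightarrow> ('v, 'h) action"
  tm :: "nat \<Rightarrow> time"
  st :: "nat \<Rightarrow> proc \<Rightarrow> ('v, 'h) lstate"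
  sent :: "nat \<Rightarrow> (proc \<times> ('v, 'h) msg) set"
  decision :: "nat \<Rightarrow> 'v option"

definition sent_before ::
    "('v, 'h) execution \<Rightarrow> nat \<Rightarrow> proc \<Rightarrow> proc \<Rightarrow> ('v, 'h) msg \<Rightarrow> bool" where
  "sent_before R k j i m \<longleftrightarrow> (\<exists>k'<k. who R k' = j \<and> (i, m) \<in> sent R k')"

text \<open>
  Assumptions \<open>link\<close> and \<open>unforgeable\<close> give faulty processes full power subject to authenticated links
  and unforgeable signatures: they may at any time send any message whose parts signed by correct
  processes have been sent by these processes. Assumption \<open>urgent\<close> expresses that local processing
  takes zero time: time does not pass while a handler is pending.
\<close>

locale sbft_execution = sbft f valid hash myval Ff
  for f :: nat
    and valid :: "'v \<Rightarrow> bool"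
    and hash :: "'v \<Rightarrow> 'h"
    and myval :: "proc \<Rightarrow> 'v"
    and Ff :: "view \<Rightarrow> time" +
  fixes GST \<delta> :: time
    and R :: "('v, 'h) execution"
  assumes hash_inj: "inj hash"
    and correct_procs: "correct R \<subseteq> procs"
    and faulty_bound: "card (procs - correct R) \<le> f"
    and myval_valid: "i \<in> correct R \<Longrightarrow> valid (myval i)"
    and delta_nonneg: "0 \<le> \<delta>"
    and clock_mono: "i \<in> correct R \<Longrightarrow> mono (clock R i)"
    and clock_no_drift:
      "\<lbrakk>i \<in> correct R; GST \<le> t; t \<le> t'\<rbrakk> \<Longrightarrow> clock R i t' - clock R i t = t' - t"
    and time_start: "0 \<le> tm R 0"
    and time_mono: "mono (tm R)"
    and time_diverges: "filterlim (tm R) at_top sequentially"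
    and who_correct: "who R k \<in> correct R"
    and initial: "i \<in> correct R \<Longrightarrow> st R 0 i = init_state"
    and local_step:
      "step (who R k) (clock R (who R k) (tm R k)) (st R k (who R k)) (act R k)
         (st R (Suc k) (who R k)) (sent R k) (decision R k)"
    and frame: "\<lbrakk>i \<in> correct R; i \<noteq> who R k\<rbrakk> \<Longrightarrow> st R (Suc k) i = st R k i"
    and urgent:
      "\<lbrakk>i \<in> correct R; tm R k \<le> t; t < tm R (Suc k)\<rbrakk>
         \<Longrightarrow> \<not> pending i (clock R i t) (st R (Suc k) i) h"
    and starts: "i \<in> correct R \<Longrightarrow> \<exists>k. who R k = i \<and> act R k = Start"
    and link:
      "act R k = Recv j m \<Longrightarrow> j \<in> procs \<and> (j \<in> correct R \<longrightarrow> sent_before R k j (who R k) m)"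
    and unforgeable:
      "\<lbrakk>act R k = Recv j m; p \<in> msg_parts m; msg_signer p \<in> correct R\<rbrakk>
         \<Longrightarrow> \<exists>i. sent_before R k (msg_signer p) i p"
    and delivery:
      "\<lbrakk>(i, m) \<in> sent R k; i \<in> correct R; GST \<le> tm R k\<rbrakk>
         \<Longrightarrow> \<exists>k'>k. who R k' = i \<and> act R k' = Recv (who R k) m \<and> tm R k' \<le> tm R k + \<delta>"
    and self_delivery:
      "(who R k, m) \<in> sent R k \<Longrightarrow> \<exists>k'>k. who R k' = who R k \<and> act R k' = Recv (who R k) m"

definition timeout_function :: "(view \<Rightarrow> time) \<Rightarrow> bool" where
  "timeout_function F \<longleftrightarrow> mono F \<and> F 0 = 0 \<and> (\<forall>\<theta>. \<exists>v. \<forall>v'\<ge>v. F v' > \<theta>)"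

text \<open>\<open>enters R i v t\<close> says that \<open>E\<^sub>i(v)\<close> is defined and equal to \<open>t\<close>.\<close>

definition enters :: "('v, 'h) execution \<Rightarrow> proc \<Rightarrow> view \<Rightarrow> time \<Rightarrow> bool" where
  "enters R i v t \<longleftrightarrow> (\<exists>k. who R k = i \<and> act R k = NewView v \<and> tm R k = t)"

definition E_first :: "('v, 'h) execution \<Rightarrow> view \<Rightarrow> time" where
  "E_first R v = Min {t. \<exists>i\<in>correct R. enters R i v t}"

definition E_last :: "('v, 'h) execution \<Rightarrow> view \<Rightarrow> time" where
  "E_last R v = Max {t. \<exists>i\<in>correct R. enters R i v t}"

text \<open>
  The first assumption makes the entry times well defined: a process is notified of each view at
  most once.
\<close>

locale synchronizer =
  fixes GST :: time and d :: time and F :: "view \<Rightarrow> time" and \<V> :: view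
    and R :: "('v, 'h) execution"
  assumes notified_once:
      "\<lbrakk>who R k \<in> correct R; who R k' = who R k; act R k = NewView v; act R k' = NewView v\<rbrakk>
         \<Longrightarrow> k' = k"
    and view_pos: "\<V> \<ge> 1"
    and P1: "\<lbrakk>i \<in> correct R; v < v'; enters R i v t; enters R i v' t'\<rbrakk> \<Longrightarrow> t < t'"
    and P2: "E_first R \<V> \<ge> GST"
    and P3: "\<lbrakk>i \<in> correct R; v \<ge> \<V>\<rbrakk> \<Longrightarrow> \<exists>t. enters R i v t"
    and P4: "v \<ge> \<V> \<Longrightarrow> E_last R v \<le> E_first R v + d"
    and P5: "v \<ge> \<V> \<Longrightarrow> E_first R (v + 1) \<ge> E_first R v + F v"

definition decides_at :: "('v, 'h) execution \<Rightarrow> proc \<Rightarrow> view \<Rightarrow> time \<Rightarrow> bool" where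
  "decides_at R i v t \<longleftrightarrow>
     (\<exists>k x. who R k = i \<and> tm R k = t \<and> curr_view (st R k i) = v \<and> decision R k = Some x)"

end

theory Submission
  imports Defs
begin

text \<open>
  All correct processes stay in view \<open>v\<close> from \<open>E_last R v\<close> until at least \<open>E_first R v + F v\<close>, which
  is more than \<open>F\<^sub>f v + 3 * \<delta>\<close> after \<open>E_last R v\<close>. This window accommodates one message delay for
  \<open>NEWLEADER\<close>, one for \<open>PROPOSE\<close>, the fast-path timer (during which all \<open>PREPARED\<close> messages arrive)
  and one delay for \<open>COMMITTED\<close>.

  A buffered message for view \<open>v\<close> from a correct process can be dropped only in favour of another
  message with the same signer and type and a view of at least \<open>v\<close>. Signatures being unforgeable, the
  signer would have sent that message itself; but before the window ends it has entered no view
  above \<open>v\<close>, and it sends only one message of each type per view.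

  The proposal of the leader is accepted since the value selected is valid: a nonzero locked view is
  backed by a certificate signed by some correct process, and a fast candidate is supported by \<open>f + 1\<close>
  messages, one of them from a correct process. Both have checked validity before voting.
\<close>

lemma buffer_inbox:
  assumes "buffer m s s'"
  shows "\<exists>I \<subseteq> insert m (inbox s). s' = s\<lparr>inbox := I\<rparr>"
  using assms
proof cases
  case past
  then show ?thesis by (intro exI[of _ "inbox s"]) auto
next
  case current
  then show ?thesis by blast
next
  case (store Rivals)
  then show ?thesis by (intro exI[of _ "insert m (inbox s - Rivals)"]) auto
next
  case (discard r)
  then show ?thesis by (intro exI[of _ "inbox s"]) auto
qed

section \<open>Single local steps, the state invariant and the selection rule\<close>

context sbft
begin

lemma finite_procs: "finite procs"
  and card_procs: "card procs = 3 * f + 1"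
  by (simp_all add: procs_def)

lemma safe_proposal_value:
  assumes "safe_proposal w x M j"
  shows "j = leader w" and "\<exists>y. x = Some y \<and> valid y"
  using assms unfolding safe_proposal_def by blast+

inductive_cases step_NewViewE: "step i c s (NewView w) s' out d"
inductive_cases step_RecvE: "step i c s (Recv j m) s' out d"
inductive_cases step_AcceptE: "step i c s (Run HAccept) s' out d"
inductive_cases step_LockE: "step i c s (Run HLock) s' out d"
inductive_cases step_DecideE: "step i c s (Run HDecide) s' out d"

lemma step_NewView:
  assumes "step i c s (NewView w) s' out d"
  shows "w \<ge> 1" and "s' = s\<lparr>curr_view := w, voted := Some False, ran := {}\<rparr>"
    and "w \<noteq> 1 \<Longrightarrow> (leader w, MNewLeader (NewLeader w (locked_view s) (prepared_val s) (cert s)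
           (pre_view s) (curr_val s) i)) \<in> out"
    and "w = 1 \<Longrightarrow> i = leader 1 \<Longrightarrow> procs \<times> {MPropose 1 (Some (myval i)) {} i} \<subseteq> out"
proof -
  show "w \<ge> 1" and "s' = s\<lparr>curr_view := w, voted := Some False, ran := {}\<rparr>"
    using assms by (elim step_NewViewE; simp)+
  show "(leader w, MNewLeader (NewLeader w (locked_view s) (prepared_val s) (cert s)
      (pre_view s) (curr_val s) i)) \<in> out" if "w \<noteq> 1"
    using assms that by (elim step_NewViewE) simp
  show "procs \<times> {MPropose 1 (Some (myval i)) {} i} \<subseteq> out" if "w = 1" and "i = leader 1"
    using assms that by (elim step_NewViewE) simp
qed

lemma step_curr_view:
  assumes "step i c s a s' out d" and "\<And>w. a \<noteq> NewView w"
  shows "curr_view s' = curr_view s"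
  using assms by cases (auto dest!: buffer_inbox)

lemma step_ran:
  assumes "step i c s a s' out d"
  shows "(\<And>w. a \<noteq> NewView w) \<Longrightarrow> ran s \<subseteq> ran s'"
    and "ran s' \<subseteq> ran s \<union> {h. a = Run h}"
    and "a = Run h \<Longrightarrow> h \<in> ran s'"
  by (rule step.cases[OF assms]; auto dest!: buffer_inbox)+

text \<open>Apart from acceptance no handler writes the value, the vote or the timer, and acceptance
  requires that no vote has been cast yet. Hence a vote freezes all three for the rest of the
  view.\<close>

lemma step_voted:
  assumes "step i c s a s' out d" and "\<And>w. a \<noteq> NewView w" and "voted s = Some True"
  shows "voted s' = Some True" and "curr_val s' = curr_val s" and "timer s' = timer s"
  by (rule step.cases[OF assms(1)]; use assms(2,3) in \<open>auto dest!: buffer_inbox\<close>)+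

lemma step_inbox:
  assumes "step i c s a s' out d" and "\<And>j m. a \<noteq> Recv j m"
  shows "inbox s' = inbox s"
  using assms by cases auto

lemma step_Recv:
  assumes "step i c s (Recv j m) s' out d"
  shows "buffer m s s'"
  using assms by (rule step_RecvE)

lemma step_decision:
  assumes "step i c s (Run HDecide) s' out d"
  shows "\<exists>x. d = Some x"
  using assms by (blast elim: step_DecideE)

lemma step_Accept:
  assumes "step i c s (Run HAccept) s' out d"
  shows "\<exists>M y. MPropose (curr_view s) (Some y) M (leader (curr_view s)) \<in> inbox s \<and>
    curr_val s' = Some y \<and> voted s' = Some True \<and> timer s' = Some (c + Ff (curr_view s)) \<and>
    out = procs \<times> {MPrepared (Prepared (curr_view s) (hash y) i)}"
  using assms by (elim step_AcceptE) (auto dest: safe_proposal_value(1))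

lemma step_Lock:
  assumes "step i c s (Run HLock) s' out d"
  shows "\<exists>x. voted s = Some True \<and> curr_val s = Some x \<and>
    out = procs \<times> {MCommitted (curr_view s) (hash x) i}"
  using assms by (elim step_LockE) auto

lemma sent_signer_view:
  assumes "step i c s a s' out d" and "(j, m) \<in> out"
  shows "msg_signer m = i \<and> msg_view m = curr_view s'"
  using assms by cases (auto split: if_splits)

lemma sent_newleader:
  assumes "step i c s a s' out d" and "(j, MNewLeader m) \<in> out"
  shows "\<exists>w. a = NewView w \<and>
    m = NewLeader w (locked_view s) (prepared_val s) (cert s) (pre_view s) (curr_val s) i"
  using assms by cases (auto split: if_splits)

text \<open>View 1 stands apart because its proposal is part of entering the view, while
  \<open>HPropose\<close> is barred there. Both triggers occur at most once per view, which is what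
  uniqueness of proposals rests on.\<close>

lemma sent_propose:
  assumes "step i c s a s' out d" and "(j, MPropose w x M l) \<in> out"
  shows "w = 1 \<and> a = NewView 1 \<or> w \<noteq> 1 \<and> a = Run HPropose \<and> HPropose \<notin> ran s"
  using assms by cases (auto split: if_splits)

lemma sent_prepared:
  assumes "step i c s a s' out d" and "(j, MPrepared p) \<in> out"
  shows "voted s = Some False \<and> voted s' = Some True \<and> a = Run HAccept \<and>
    (\<exists>y. valid y \<and> curr_val s' = Some y \<and> p = Prepared (curr_view s) (hash y) i)"
  using assms by cases (auto split: if_splits dest: safe_proposal_value(2))

lemma sent_committed:
  assumes "step i c s a s' out d" and "(j, MCommitted w h l) \<in> out"
  shows "a = Run HLock \<and> w = curr_view s \<and> l = i \<and> voted s = Some True \<and>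
    (\<exists>x. curr_val s = Some x \<and> h = hash x)"
  using assms by cases (auto split: if_splits)

text \<open>Only entry to view 1 can send messages of two types in one step, hence the restriction
  to equal types.\<close>

lemma sent_same_step:
  assumes "step i c s a s' out d" and "(j, m) \<in> out" and "(j', m') \<in> out" and "same_type m m'"
  shows "m = m'"
  using assms by cases (auto split: if_splits)

text \<open>The first three conjuncts make the next \<open>NEWLEADER\<close> message pass
  \<open>valid_newleader\<close>; the fourth makes fast candidates of correct processes valid; the
  fifth keeps the first one true under locking. The last three translate \<open>ran\<close> into
  state: without \<open>HAccept\<close> the vote is still open, and with \<open>HLock\<close> the
  decision handler sees the right locked view.\<close>

definition state_inv :: "('v, 'h) lstate \<Rightarrow> bool" where
  "state_inv s \<longleftrightarrow>
     locked_view s \<le> pre_view s \<and> pre_view s \<le> curr_view s \<and>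
     (locked_view s \<noteq> 0 \<longrightarrow>
        (\<exists>C x. cert s = Some C \<and> prepared_val s = Some x \<and> prepared C (locked_view s) (hash x))) \<and>
     (pre_view s \<noteq> 0 \<longrightarrow> (\<exists>x. curr_val s = Some x \<and> valid x)) \<and>
     (voted s = Some True \<longrightarrow> pre_view s = curr_view s) \<and>
     (curr_view s \<noteq> 0 \<longrightarrow> voted s \<noteq> None) \<and>
     (HAccept \<in> ran s \<longleftrightarrow> voted s = Some True) \<and>
     (HLock \<in> ran s \<longrightarrow> locked_view s = curr_view s)"

lemma state_inv_init: "state_inv init_state"
  by (simp add: state_inv_def init_state_def)

lemma step_state_inv:
  assumes step: "step i c s a s' out d" and inv: "state_inv s"
    and fresh: "\<And>w. a = NewView w \<Longrightarrow> curr_view s < w"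
  shows "state_inv s'"
  using step
proof cases
  case start
  then show ?thesis using inv by simp
next
  case (new_view w nl out_nl out_prop)
  have "curr_view s < w" using fresh new_view by blast
  then show ?thesis using inv unfolding new_view by (auto simp: state_inv_def)
next
  case (recv m j)
  obtain I where "s' = s\<lparr>inbox := I\<rparr>" using recv buffer_inbox by blast
  then show ?thesis using inv by (simp add: state_inv_def)
next
  case (propose w M xs vs xf vf x)
  show ?thesis using inv unfolding propose(2) by (simp add: state_inv_def)
next
  case (accept w x M j y)
  have "\<exists>y. x = Some y \<and> valid y" using accept safe_proposal_value(2) by blast
  then show ?thesis using inv accept(6,7) unfolding accept(2) by (auto simp: state_inv_def)
next
  case (fast_decide w x)
  show ?thesis using inv unfolding fast_decide(2) by (simp add: state_inv_def)
next
  case (lock t w x C)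
  \<comment> \<open>Locking raises \<open>locked_view\<close> to the current view, which equals
    \<open>pre_view\<close> because the process has voted.\<close>
  show ?thesis using inv lock unfolding lock(2) by (auto simp: state_inv_def)
next
  case (decide w x Q)
  show ?thesis using inv unfolding decide(2) by (simp add: state_inv_def)
qed

lemma newleader_quorum_finite:
  assumes "newleader_quorum w M"
  shows "finite M" and "M \<noteq> {}" and "inj_on nl_signer M" and "nl_signer ` M \<subseteq> procs"
proof -
  obtain Q where "Q \<subseteq> procs" "card Q = 2 * f + 1" and bij: "bij_betw nl_signer M Q"
    using assms by (auto simp: newleader_quorum_def quorum_def)
  then have "finite Q" "Q \<noteq> {}" using finite_procs finite_subset by auto
  then show "finite M" "M \<noteq> {}" using bij by (auto simp: bij_betw_finite bij_betw_def)
  show "inj_on nl_signer M" "nl_signer ` M \<subseteq> procs"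
    using bij \<open>Q \<subseteq> procs\<close> by (auto simp: bij_betw_def)
qed

lemma slow_choice_total:
  assumes "finite M" and "M \<noteq> {}"
  shows "\<exists>x u. slow_choice M x u"
proof -
  have "Max (nl_locked ` M) \<in> nl_locked ` M" using assms by simp
  then obtain m where "m \<in> M" "nl_locked m = Max (nl_locked ` M)" by fastforce
  then show ?thesis unfolding slow_choice_def by metis
qed

text \<open>The default outcome carries view 0, so a nonzero view can only come from the branch with
  a unique maximal candidate.\<close>

lemma fast_choice_candidate:
  assumes "fast_choice M = (x, u)" and "u \<noteq> 0"
  shows "(x, u) \<in> fast_candidates M"
proof -
  let ?u = "Max (snd ` fast_candidates M)"
  have "\<exists>!x. (x, ?u) \<in> fast_candidates M" and "(x, u) = (THE x. (x, ?u) \<in> fast_candidates M, ?u)"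
    using assms unfolding fast_choice_def Let_def by (auto split: if_splits)
  then show ?thesis using theI'[of "\<lambda>x. (x, ?u) \<in> fast_candidates M"] by simp
qed

end

section \<open>Executions: correct members of quorums, real time, origin of messages\<close>

context sbft_execution
begin

lemma finite_correct: "finite (correct R)"
  using correct_procs finite_procs finite_subset by blast

lemma card_correct: "card (correct R) \<ge> 2 * f + 1"
proof -
  have "card (procs - correct R) = card procs - card (correct R)"
    using correct_procs finite_correct by (simp add: card_Diff_subset)
  then show ?thesis using faulty_bound card_procs by linarith
qed

lemma contains_correct:
  assumes "Q \<subseteq> procs" and "card Q \<ge> f + 1"
  shows "\<exists>j\<in>Q. j \<in> correct R"
proof (rule ccontr)
  assume "\<not> ?thesis"
  then have "Q \<subseteq> procs - correct R" using assms by auto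
  then have "card Q \<le> f" using finite_procs faulty_bound card_mono[of "procs - correct R" Q] by auto
  then show False using assms by simp
qed

lemma tm_le: "k \<le> k' \<Longrightarrow> tm R k \<le> tm R k'"
  using time_mono by (rule monoD)

text \<open>Divergence of time leaves finitely many steps up to \<open>T\<close>, and monotonicity
  makes them an initial segment. The step \<open>k0\<close> ensures that the segment is nonempty, so
  that its maximum exists.\<close>

lemma last_step_before:
  assumes "tm R k0 \<le> T"
  obtains K where "\<And>k. tm R k \<le> T \<longleftrightarrow> k \<le> K"
proof -
  have "eventually (\<lambda>k. tm R k > T) sequentially"
    using time_diverges by (simp add: filterlim_at_top_dense)
  then obtain N where N: "\<And>k. k \<ge> N \<Longrightarrow> tm R k > T" by (auto simp: eventually_sequentially)
  define S where "S = {k. tm R k \<le> T}"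
  have "S \<subseteq> {..N}" using N by (auto simp: S_def) (meson leD le_cases)
  then have fin: "finite S" using finite_subset by blast
  have ne: "S \<noteq> {}" using assms by (auto simp: S_def)
  have "tm R k \<le> T \<longleftrightarrow> k \<le> Max S" for k
  proof
    assume "tm R k \<le> T"
    then show "k \<le> Max S" using fin by (simp add: S_def)
  next
    assume "k \<le> Max S"
    moreover have "Max S \<in> S" using fin ne by simp
    ultimately show "tm R k \<le> T" using tm_le[of k "Max S"] by (simp add: S_def)
  qed
  then show thesis by (rule that)
qed

lemma step_of:
  assumes "who R k = i"
  shows "step i (clock R i (tm R k)) (st R k i) (act R k) (st R (Suc k) i) (sent R k) (decision R k)"
  using local_step[of k] assms by simp

lemma inbox_received:
  assumes "i \<in> correct R" and "m \<in> inbox (st R k i)"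
  shows "\<exists>k'<k. \<exists>j. who R k' = i \<and> act R k' = Recv j m"
  using assms(2)
proof (induction k)
  case 0
  then show ?case using initial[OF assms(1)] by (simp add: init_state_def)
next
  case (Suc k)
  show ?case
  proof (cases "m \<in> inbox (st R k i)")
    case True
    then show ?thesis using Suc.IH less_Suc_eq by blast
  next
    case new: False
    have who: "who R k = i" using frame[OF assms(1), of k] Suc.prems new by metis
    have "\<exists>j m'. act R k = Recv j m'"
      using step_inbox[OF step_of[OF who]] Suc.prems new by metis
    then obtain j m' where act: "act R k = Recv j m'" by blast
    then have "buffer m' (st R k i) (st R (Suc k) i)" using step_of[OF who] step_Recv by simp
    then have "m = m'" using buffer_inbox Suc.prems new by force
    then show ?thesis using who act by blast
  qed
qed

text \<open>Inbox messages have all been received, and unforgeability also reaches nested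
  signatures, such as those in the certificate of a \<open>NEWLEADER\<close> message from a faulty
  process.\<close>

lemma inbox_parts_sent:
  assumes "i \<in> correct R" and "m \<in> inbox (st R k i)"
    and "p \<in> msg_parts m" and "msg_signer p \<in> correct R"
  shows "\<exists>l. sent_before R k (msg_signer p) l p"
proof -
  obtain k' j where k': "k' < k" "act R k' = Recv j m" using inbox_received[OF assms(1,2)] by blast
  obtain l where "sent_before R k' (msg_signer p) l p" using unforgeable[OF k'(2) assms(3,4)] by blast
  then show ?thesis using k'(1) unfolding sent_before_def by (meson less_trans)
qed

lemma self_part: "m \<in> msg_parts m"
  by (cases m) auto

text \<open>Among the signers of a certificate is a correct process. It accepted a safe proposal and
  hence a valid value, and injectivity of \<open>hash\<close> identifies that value with
  \<open>x\<close>.\<close>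

lemma prepared_valid:
  assumes "prepared C w (hash x)"
    and "\<And>p. p \<in> C \<Longrightarrow> p_signer p \<in> correct R \<Longrightarrow> \<exists>k l. (l, MPrepared p) \<in> sent R k"
  shows "valid x"
proof -
  obtain Q where Q: "Q \<subseteq> procs" "card Q \<ge> 2 * f + 1" and C: "C = {Prepared w (hash x) j | j. j \<in> Q}"
    using assms(1) by (auto simp: prepared_def)
  obtain j where "j \<in> Q" "j \<in> correct R" using contains_correct[of Q] Q by auto
  then obtain k l where "(l, MPrepared (Prepared w (hash x) j)) \<in> sent R k"
    using assms(2)[of "Prepared w (hash x) j"] C by auto
  from sent_prepared[OF local_step this] show ?thesis using hash_inj by (auto dest: injD)
qed

end

section \<open>View changes of correct processes\<close>

locale sbft_good_view =
  sbft_execution f valid hash myval Ff GST \<delta> R + synchronizer GST "2 * \<delta>" F \<V> R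
  for f :: nat
    and valid :: "'v \<Rightarrow> bool"
    and hash :: "'v \<Rightarrow> 'h"
    and myval :: "proc \<Rightarrow> 'v"
    and F Ff :: "view \<Rightarrow> time"
    and GST \<delta> :: time
    and R :: "('v, 'h) execution"
    and \<V> :: view +
  fixes v :: view
  assumes F_timeout: "timeout_function F"
    and v_ge: "v \<ge> \<V>"
    and Ff_v: "Ff v > 2 * \<delta>"
    and F_v: "F v - Ff v > 5 * \<delta>"
    and leader_correct: "leader v \<in> correct R"
begin

lemma st_entered:
  assumes "who R k = i" and "act R k = NewView w"
  shows "st R (Suc k) i = (st R k i)\<lparr>curr_view := w, voted := Some False, ran := {}\<rparr>"
  by (rule step_NewView(2)[OF step_of[OF assms(1), unfolded assms(2)]])

lemma curr_view_entered:
  assumes "who R k = i" and "act R k = NewView w"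
  shows "curr_view (st R (Suc k) i) = w"
  by (simp add: st_entered[OF assms])

lemma curr_view_unchanged:
  assumes "i \<in> correct R" and "\<not> (who R k = i \<and> (\<exists>w. act R k = NewView w))"
  shows "curr_view (st R (Suc k) i) = curr_view (st R k i)"
proof (cases "who R k = i")
  case True
  then have "act R k \<noteq> NewView w" for w using assms(2) by blast
  then show ?thesis by (rule step_curr_view[OF step_of[OF True]])
next
  case False
  then show ?thesis using frame[OF assms(1)] by auto
qed

lemma curr_view_notified:
  assumes "i \<in> correct R"
  shows "curr_view (st R k i) = 0 \<or>
    (\<exists>k'<k. who R k' = i \<and> act R k' = NewView (curr_view (st R k i)))"
proof (induction k)
  case 0
  then show ?case using initial[OF assms] by (simp add: init_state_def)
next
  case (Suc k)
  show ?case
  proof (cases "who R k = i \<and> (\<exists>w. act R k = NewView w)")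
    case True
    then obtain w where w: "who R k = i" "act R k = NewView w" by blast
    then have "curr_view (st R (Suc k) i) = w" by (rule curr_view_entered)
    then show ?thesis using w by blast
  next
    case False
    then have "curr_view (st R (Suc k) i) = curr_view (st R k i)"
      by (rule curr_view_unchanged[OF assms])
    then show ?thesis using Suc.IH by (auto simp: less_Suc_eq)
  qed
qed

text \<open>The current view, if nonzero, was entered at an earlier step. Being notified now of a
  lower view would contradict P1, and of the same view \<open>notified_once\<close>.\<close>

lemma new_view_increases:
  assumes "who R k = i" and "act R k = NewView w"
  shows "curr_view (st R k i) < w"
proof -
  have i: "i \<in> correct R" using who_correct assms by blast
  have "w \<ge> 1" by (rule step_NewView(1)[OF step_of[OF assms(1), unfolded assms(2)]])
  show ?thesis
  proof (rule ccontr)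
    let ?u = "curr_view (st R k i)"
    assume neg: "\<not> ?thesis"
    then have "?u \<noteq> 0" using \<open>w \<ge> 1\<close> by simp
    then obtain k' where k': "k' < k" "who R k' = i" "act R k' = NewView ?u"
      using curr_view_notified[OF i, of k] by auto
    show False
    proof (cases "?u = w")
      case True
      then show False using notified_once[of k k' w] k' assms i by auto
    next
      case False
      then have "tm R k < tm R k'" using P1[OF i, of w ?u] neg k' assms
        unfolding enters_def by (metis linorder_neqE_nat)
      then show False using tm_le[of k' k] k'(1) by simp
    qed
  qed
qed

lemma curr_view_Suc:
  assumes "i \<in> correct R"
  shows "curr_view (st R k i) \<le> curr_view (st R (Suc k) i)"
proof (cases "who R k = i \<and> (\<exists>w. act R k = NewView w)")
  case True
  then obtain w where w: "who R k = i" "act R k = NewView w" by blast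
  then have "curr_view (st R (Suc k) i) = w" by (rule curr_view_entered)
  then show ?thesis using new_view_increases[OF w] by simp
next
  case False
  then have "curr_view (st R (Suc k) i) = curr_view (st R k i)"
    by (rule curr_view_unchanged[OF assms])
  then show ?thesis by simp
qed

lemma curr_view_mono:
  assumes "i \<in> correct R" and "k \<le> k'"
  shows "curr_view (st R k i) \<le> curr_view (st R k' i)"
  using assms(2) by (rule lift_Suc_mono_le[rotated]) (rule curr_view_Suc[OF assms(1)])

lemma invariant:
  assumes "i \<in> correct R"
  shows "state_inv (st R k i)"
proof (induction k)
  case 0
  then show ?case using initial[OF assms] state_inv_init by simp
next
  case (Suc k)
  then show ?case
    using frame[OF assms, of k] step_state_inv[OF step_of Suc] new_view_increases[of k i]
    by (cases "who R k = i") auto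
qed

section \<open>Behaviour within one view and uniqueness of sent messages\<close>

lemma same_view_step:
  assumes i: "i \<in> correct R" and "curr_view (st R k i) = curr_view (st R (Suc k) i)"
    and "who R k = i"
  shows "act R k \<noteq> NewView w"
  using assms(2,3) new_view_increases[of k i w] curr_view_entered[of k i w] by auto

lemma same_view:
  assumes i: "i \<in> correct R" and le: "k \<le> k'"
    and view: "curr_view (st R k i) = curr_view (st R k' i)"
  shows "ran (st R k i) \<subseteq> ran (st R k' i)"
    and "voted (st R k i) = Some True \<Longrightarrow> voted (st R k' i) = Some True \<and>
      curr_val (st R k' i) = curr_val (st R k i) \<and> timer (st R k' i) = timer (st R k i)"
proof -
  have "ran (st R k i) \<subseteq> ran (st R k' i) \<and>
    (voted (st R k i) = Some True \<longrightarrow> voted (st R k' i) = Some True \<and>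
      curr_val (st R k' i) = curr_val (st R k i) \<and> timer (st R k' i) = timer (st R k i))"
    using le view
  proof (induction k' rule: dec_induct)
    case base
    then show ?case by simp
  next
    case (step n)
    \<comment> \<open>Views never decrease, so agreement at both ends pins all states in between to
      the same view.\<close>
    have n: "curr_view (st R k i) = curr_view (st R n i)"
      "curr_view (st R n i) = curr_view (st R (Suc n) i)"
      using curr_view_mono[OF i step.hyps(1)] curr_view_Suc[OF i, of n] step.prems by auto
    show ?case
    proof (cases "who R n = i")
      case True
      note nonew = same_view_step[OF i n(2) True]
      show ?thesis
        using step.IH[OF n(1)] step_ran(1)[OF step_of[OF True] nonew]
          step_voted[OF step_of[OF True] nonew]
        by auto
    next
      case False
      then show ?thesis using step.IH[OF n(1)] frame[OF i, of n] by simp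
    qed
  qed
  then show "ran (st R k i) \<subseteq> ran (st R k' i)"
    and "voted (st R k i) = Some True \<Longrightarrow> voted (st R k' i) = Some True \<and>
      curr_val (st R k' i) = curr_val (st R k i) \<and> timer (st R k' i) = timer (st R k i)"
    by blast+
qed

text \<open>Every entry empties \<open>ran\<close>, so whatever it contains was run during the
  present view.\<close>

lemma handler_ran:
  assumes i: "i \<in> correct R" and "h \<in> ran (st R k i)"
  shows "\<exists>k'<k. who R k' = i \<and> act R k' = Run h \<and> curr_view (st R k' i) = curr_view (st R k i)"
  using assms(2)
proof (induction k)
  case 0
  then show ?case using initial[OF i] by (simp add: init_state_def)
next
  case (Suc k)
  show ?case
  proof (cases "who R k = i")
    case True
    note step = step_of[OF True]
    have nonew: "act R k \<noteq> NewView w" for w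
      using st_entered[OF True, of w] Suc.prems by auto
    have view: "curr_view (st R (Suc k) i) = curr_view (st R k i)"
      using step_curr_view[OF step nonew] .
    have "h \<in> ran (st R k i) \<or> act R k = Run h" using step_ran(2)[OF step] Suc.prems by blast
    then show ?thesis
    proof
      assume "h \<in> ran (st R k i)"
      then show ?thesis using Suc.IH view less_Suc_eq by metis
    next
      assume "act R k = Run h"
      then show ?thesis using True view by auto
    qed
  next
    case False
    then show ?thesis using Suc frame[OF i, of k] less_Suc_eq by metis
  qed
qed

text \<open>Messages carry the view of their sender, so both steps belong to one stay in a view and
  the later one is not an entry. This rules out a second \<open>NEWLEADER\<close>; a second
  \<open>PROPOSE\<close> is blocked by \<open>ran\<close> and a second \<open>PREPARED\<close> by
  \<open>voted\<close>. \<open>COMMITTED\<close> may be repeated, but with the value frozen by the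
  vote its content is the same.\<close>

lemma sent_unique_less:
  assumes less: "k < k'" and who: "who R k = i" "who R k' = i"
    and sent: "(l, m) \<in> sent R k" "(l', m') \<in> sent R k'"
    and eq: "same_type m m'" "msg_view m = msg_view m'"
  shows "m = m'"
proof -
  have i: "i \<in> correct R" using who_correct who by blast
  note step = step_of[OF who(1)] and step' = step_of[OF who(2)]
  have view: "curr_view (st R (Suc k) i) = msg_view m" "curr_view (st R (Suc k') i) = msg_view m"
    using sent_signer_view[OF step sent(1)] sent_signer_view[OF step' sent(2)] eq by auto
  have view': "curr_view (st R k' i) = msg_view m"
    using curr_view_mono[OF i, of "Suc k" k'] curr_view_Suc[OF i, of k'] view less by auto
  have nonew: "act R k' \<noteq> NewView w" for w
    using same_view_step[OF i _ who(2)] view view' by simp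
  have stay: "curr_view (st R (Suc k) i) = curr_view (st R k' i)" using view view' by simp
  note sv = same_view[OF i _ stay]
  show ?thesis
  proof (cases m)
    case (MNewLeader n)
    then obtain n' where "m' = MNewLeader n'" using eq by (cases m') auto
    then show ?thesis using sent_newleader[OF step'] sent nonew by metis
  next
    case (MPropose w x M j)
    then obtain w' x' M' j' where m': "m' = MPropose w' x' M' j'" using eq by (cases m') auto
    have "w' \<noteq> 1" "HPropose \<notin> ran (st R k' i)"
      using sent_propose[OF step'] sent m' nonew by metis+
    moreover have "w = w'" using MPropose m' eq by simp
    ultimately have "act R k = Run HPropose" using sent_propose[OF step] sent MPropose by metis
    then have "HPropose \<in> ran (st R (Suc k) i)" using step_ran(3)[OF step] by simp
    then show ?thesis using sv(1) less \<open>HPropose \<notin> ran (st R k' i)\<close> by auto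
  next
    case (MPrepared p)
    then obtain p' where m': "m' = MPrepared p'" using eq by (cases m') auto
    have "voted (st R (Suc k) i) = Some True" using sent_prepared[OF step] sent MPrepared by blast
    then have "voted (st R k' i) = Some True" using sv(2) less by auto
    moreover have "voted (st R k' i) = Some False" using sent_prepared[OF step'] sent m' by blast
    ultimately show ?thesis by simp
  next
    case (MCommitted w h j)
    then obtain w' h' j' where m': "m' = MCommitted w' h' j'" using eq by (cases m') auto
    have c: "act R k = Run HLock" "w = curr_view (st R k i)" "j = i" "voted (st R k i) = Some True"
        "\<exists>x. curr_val (st R k i) = Some x \<and> h = hash x"
      using sent_committed[OF step sent(1)[unfolded MCommitted]] by blast+
    have c': "w' = curr_view (st R k' i)" "j' = i"
        "\<exists>x. curr_val (st R k' i) = Some x \<and> h' = hash x"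
      using sent_committed[OF step' sent(2)[unfolded m']] by blast+
    have "w = w'" using MCommitted m' eq by simp
    then have "curr_val (st R k' i) = curr_val (st R k i)"
      using same_view(2)[OF i, of k k'] less c c' by auto
    then show ?thesis using c c' MCommitted m' \<open>w = w'\<close> by auto
  qed
qed

lemma sent_unique:
  assumes "who R k = who R k'"
    and "(l, m) \<in> sent R k" "(l', m') \<in> sent R k'"
    and "same_type m m'" "msg_view m = msg_view m'"
  shows "m = m'"
proof -
  have sym: "same_type m' m" using assms(4) by (cases m; cases m') auto
  consider "k < k'" | "k = k'" | "k' < k" by linarith
  then show ?thesis
  proof cases
    case 1
    then show ?thesis using sent_unique_less assms by metis
  next
    case 2
    then show ?thesis using sent_same_step[OF local_step] assms by blast
  next
    case 3
    then show ?thesis using sent_unique_less[OF 3 _ _ assms(3,2) sym] assms by simp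
  qed
qed

section \<open>Validity of the value selected by the leader\<close>

lemma sent_newleader_valid:
  assumes sent: "(l, MNewLeader m) \<in> sent R k"
  shows "valid_newleader m" and "nl_pre m \<noteq> 0 \<Longrightarrow> \<exists>x. nl_cur m = Some x \<and> valid x"
proof -
  let ?i = "who R k" and ?s = "st R k (who R k)"
  obtain w where act: "act R k = NewView w" and m: "m = NewLeader w (locked_view ?s)
      (prepared_val ?s) (cert ?s) (pre_view ?s) (curr_val ?s) ?i"
    using sent_newleader[OF local_step sent] by blast
  \<comment> \<open>The message quotes the state just before entry. Its \<open>pre_view\<close> is
    at most the old view, and this strict increase gives the bound below the new one.\<close>
  have "curr_view ?s < w" using new_view_increases[OF refl act] .
  moreover have "state_inv ?s" using invariant[OF who_correct] .
  ultimately show "valid_newleader m" and "nl_pre m \<noteq> 0 \<Longrightarrow> \<exists>x. nl_cur m = Some x \<and> valid x"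
    unfolding m state_inv_def valid_newleader_def by auto
qed

lemma proposed_value_valid:
  assumes i: "i \<in> correct R" and inbox: "MNewLeader ` M \<subseteq> inbox (st R k i)"
    and quorum: "newleader_quorum w M"
    and slow: "slow_choice M xs vs" and fast: "fast_choice M = (xf, vf)"
  shows "\<exists>y. (if vs \<ge> vf \<and> vs > 0 then xs else if vf > vs then xf else Some (myval i)) = Some y
    \<and> valid y"
proof -
  have parts: "\<exists>k l. (l, p) \<in> sent R k"
    if "m \<in> M" "p \<in> msg_parts (MNewLeader m)" "msg_signer p \<in> correct R" for m p
    using inbox_parts_sent[OF i _ that(2,3)] that(1) inbox unfolding sent_before_def by blast
  consider "vs \<ge> vf" "vs > 0" | "vf > vs" | "\<not> (vs \<ge> vf \<and> vs > 0)" "\<not> vf > vs" by blast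
  then show ?thesis
  proof cases
    case 1
    then obtain m where m: "m \<in> M" "nl_locked m = vs" "xs = nl_val m"
      using slow unfolding slow_choice_def by (auto split: if_splits)
    then obtain C x where C: "nl_cert m = Some C" "nl_val m = Some x" "prepared C vs (hash x)"
      using quorum 1 unfolding newleader_quorum_def valid_newleader_def by auto
    have "\<exists>k l. (l, MPrepared p) \<in> sent R k" if "p \<in> C" "p_signer p \<in> correct R" for p
      using parts[OF m(1), of "MPrepared p"] that C(1) by simp
    then have "valid x" by (rule prepared_valid[OF C(3)])
    then show ?thesis using 1 m C by simp
  next
    case 2
    then obtain P where P: "P \<subseteq> M" "card P = f + 1" "\<forall>m\<in>P. nl_cur m = xf" "vf = Min (nl_pre ` P)"
      using fast_choice_candidate[OF fast] unfolding fast_candidates_def by auto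
    note M = newleader_quorum_finite[OF quorum]
    \<comment> \<open>Distinct messages of a quorum have distinct signers, so the
      \<open>f + 1\<close> supporting messages come from \<open>f + 1\<close> processes, not all of
      them faulty.\<close>
    have "inj_on nl_signer P" using M(3) P(1) inj_on_subset by blast
    then have "card (nl_signer ` P) = f + 1" using P(2) by (simp add: card_image)
    then obtain m where m: "m \<in> P" "nl_signer m \<in> correct R"
      using contains_correct[of "nl_signer ` P"] M(4) P(1) by auto
    then obtain k' l where "(l, MNewLeader m) \<in> sent R k'"
      using parts[of m "MNewLeader m"] P(1) by auto
    \<comment> \<open>As \<open>vf\<close> is a minimum over \<open>P\<close> and positive, the
      correct supporter has a nonzero \<open>pre_view\<close>: it did accept the value it
      reports.\<close>
    moreover have "vf \<le> nl_pre m" using P(4) m(1) finite_subset[OF P(1) M(1)] by simp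
    ultimately have "\<exists>x. nl_cur m = Some x \<and> valid x" using sent_newleader_valid(2) 2 by auto
    then show ?thesis using P m 2 by auto
  next
    case 3
    then show ?thesis using myval_valid[OF i] by auto
  qed
qed

section \<open>Entry times and the window of view \<open>v\<close>\<close>

lemma finite_entry_times: "finite {t. \<exists>i\<in>correct R. enters R i w t}"
proof -
  \<comment> \<open>By \<open>notified_once\<close> each process contributes at most one time.
    Finiteness is what gives \<open>Min\<close> and \<open>Max\<close> in \<open>E_first\<close> and
    \<open>E_last\<close> their meaning.\<close>
  have "finite {t. enters R i w t}" if "i \<in> correct R" for i
  proof (cases "\<exists>k. who R k = i \<and> act R k = NewView w")
    case True
    then obtain k where "who R k = i" "act R k = NewView w" by blast
    then have "{t. enters R i w t} \<subseteq> {tm R k}"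
      using notified_once that unfolding enters_def by blast
    then show ?thesis using finite_subset by blast
  next
    case False
    then have "{t. enters R i w t} = {}" unfolding enters_def by blast
    then show ?thesis by simp
  qed
  then have "finite (\<Union>i\<in>correct R. {t. enters R i w t})" using finite_correct by blast
  moreover have "{t. \<exists>i\<in>correct R. enters R i w t} = (\<Union>i\<in>correct R. {t. enters R i w t})" by blast
  ultimately show ?thesis by simp
qed

lemma entry_bounds:
  assumes "i \<in> correct R" and "enters R i w t"
  shows "E_first R w \<le> t" and "t \<le> E_last R w"
  using assms finite_entry_times[of w] unfolding E_first_def E_last_def
  by (auto intro: Min_le Max_ge)

text \<open>A monotone \<open>F\<close> with \<open>F 0 = 0\<close> is nonnegative, so P5 makes
  first entry times nondecreasing from \<V> on, and P2 starts the chain.\<close>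

lemma E_first_after_GST: "w \<ge> \<V> \<Longrightarrow> E_first R w \<ge> GST"
proof (induction w rule: dec_induct)
  case base
  then show ?case using P2 .
next
  case (step w)
  have "F w \<ge> 0" using F_timeout unfolding timeout_function_def by (metis le0 monoD)
  then show ?case using P5[of w] step by simp
qed

lemma v_pos: "v \<ge> 1"
  using view_pos v_ge by simp

text \<open>No correct process enters a view above \<open>v\<close> before this time.\<close>

definition view_end :: time where
  "view_end = E_first R v + F v"

text \<open>Of the margin \<open>5 * \<delta>\<close> between \<open>F v\<close> and
  \<open>Ff v\<close>, P4 uses \<open>2 * \<delta>\<close> for the spread of entries;
  \<open>3 * \<delta>\<close> remain for message delays.\<close>

lemma deadline_before_view_end: "E_last R v + Ff v + 3 * \<delta> < view_end"
  using P4[OF v_ge] F_v unfolding view_end_def by simp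

text \<open>By P3 every correct process enters \<open>v + 1\<close>, by P1 before any higher view,
  and by P5 not before \<open>view_end\<close>.\<close>

lemma curr_view_le:
  assumes i: "i \<in> correct R" and "tm R k < view_end"
  shows "curr_view (st R (Suc k) i) \<le> v"
proof (rule ccontr)
  let ?w = "curr_view (st R (Suc k) i)"
  assume neg: "\<not> ?thesis"
  then obtain k' where k': "k' \<le> k" "who R k' = i" "act R k' = NewView ?w"
    using curr_view_notified[OF i, of "Suc k"] by (auto simp: less_Suc_eq_le)
  obtain t where t: "enters R i (v + 1) t" using P3[OF i, of "v + 1"] v_ge by auto
  have entry: "enters R i ?w (tm R k')" unfolding enters_def using k' by blast
  have "t \<le> tm R k'"
  proof (cases "?w = v + 1")
    case True
    then show ?thesis using t k' notified_once i unfolding enters_def by (metis order_refl)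
  next
    case False
    then have "v + 1 < ?w" using neg by simp
    then show ?thesis using P1[OF i _ t entry] by simp
  qed
  moreover have "t \<ge> view_end"
    using entry_bounds(1)[OF i t] P5[OF v_ge] unfolding view_end_def by simp
  ultimately show False using assms(2) tm_le[OF k'(1)] by simp
qed

lemma entry:
  assumes "i \<in> correct R"
  obtains e where "who R e = i" and "act R e = NewView v" and "tm R e \<le> E_last R v"
  using P3[OF assms v_ge] entry_bounds[OF assms] unfolding enters_def by blast

lemma in_view_since_entry:
  assumes i: "i \<in> correct R" and view: "curr_view (st R k i) = v"
  shows "\<exists>e<k. who R e = i \<and> act R e = NewView v" and "\<exists>e<k. GST \<le> tm R e"
proof -
  show *: "\<exists>e<k. who R e = i \<and> act R e = NewView v"
    using curr_view_notified[OF i, of k] view v_pos by auto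
  then obtain e where e: "e < k" "who R e = i" "act R e = NewView v" by blast
  then have "enters R i v (tm R e)" unfolding enters_def by blast
  then have "GST \<le> tm R e" using entry_bounds(1)[OF i] E_first_after_GST[OF v_ge] by force
  then show "\<exists>e<k. GST \<le> tm R e" using e by blast
qed

lemma in_view:
  assumes i: "i \<in> correct R" and e: "who R e = i" "act R e = NewView v"
    and k: "e < k" "k \<le> Suc k'" "tm R k' < view_end"
  shows "curr_view (st R k i) = v"
proof -
  have "curr_view (st R k i) \<le> v"
    using curr_view_le[OF i k(3)] curr_view_mono[OF i k(2)] by simp
  moreover have "v \<le> curr_view (st R k i)"
    using curr_view_entered[OF e] curr_view_mono[OF i, of "Suc e" k] k(1) by simp
  ultimately show ?thesis by simp
qed

section \<open>Messages for view \<open>v\<close> survive buffering\<close>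

lemma sent_in_view:
  assumes "(l, m) \<in> sent R k" and "tm R k < view_end"
  shows "msg_view m \<le> v"
  using sent_signer_view[OF local_step assms(1)] curr_view_le[OF who_correct assms(2)] by simp

lemma rival_eq:
  assumes sent: "(l, m) \<in> sent R k0" and view: "msg_view m = v"
    and r: "(l', r) \<in> sent R k1" "tm R k1 < view_end"
    and rival: "same_type r m" "msg_signer r = msg_signer m" "v \<le> msg_view r"
  shows "r = m"
proof (rule sent_unique[OF _ r(1) sent rival(1)])
  show "who R k1 = who R k0"
    using sent_signer_view[OF local_step sent] sent_signer_view[OF local_step r(1)] rival(2) by simp
  show "msg_view r = msg_view m" using sent_in_view[OF r] rival(3) view by simp
qed

text \<open>The recipient may still be in an earlier view when \<open>m\<close> arrives, so
  \<open>m\<close> must survive both its own arrival and all later ones until the handlers can use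
  it.\<close>

lemma received_kept:
  assumes i: "i \<in> correct R" and sent: "(l, m) \<in> sent R k0" and view: "msg_view m = v"
    and recv: "who R k = i" "act R k = Recv j m" and K: "k \<le> K" "tm R K < view_end"
  shows "m \<in> inbox (st R (Suc K) i)"
  using K
proof (induction K rule: dec_induct)
  case base
  have signer: "msg_signer m \<in> correct R"
    using sent_signer_view[OF local_step sent] who_correct by simp
  have le: "curr_view (st R k i) \<le> v"
    using curr_view_le[OF i base] curr_view_mono[OF i, of k "Suc k"] by simp
  have "buffer m (st R k i) (st R (Suc k) i)" using step_of[OF recv(1)] recv(2) step_Recv by simp
  then show ?case
  proof cases
    case past
    then show ?thesis using le view by simp
  next
    case (discard r)
    \<comment> \<open>The stored message that causes the rejection was sent by the same correct
      signer, so it is \<open>m\<close> itself: a copy is already there.\<close>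
    then obtain l' where "sent_before R k (msg_signer r) l' r"
      using inbox_parts_sent[OF i _ self_part, of r k] signer by auto
    then obtain k1 where k1: "k1 < k" "(l', r) \<in> sent R k1" unfolding sent_before_def by blast
    have "tm R k1 < view_end" using tm_le[of k1 k] k1 base by simp
    then have "r = m" using rival_eq[OF sent view k1(2)] discard view by simp
    then show ?thesis using discard by simp
  qed auto
next
  case (step n)
  have signer: "msg_signer m \<in> correct R"
    using sent_signer_view[OF local_step sent] who_correct by simp
  have "tm R n < view_end" using tm_le[of n "Suc n"] step.prems by simp
  then have IH: "m \<in> inbox (st R (Suc n) i)" using step.IH by simp
  show ?case
  proof (cases "who R (Suc n) = i")
    case False
    then show ?thesis using IH frame[OF i] by auto
  next
    case who: True
    show ?thesis
    proof (cases "\<exists>j' r. act R (Suc n) = Recv j' r")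
      case False
      then show ?thesis using IH step_inbox[OF step_of[OF who]] by auto
    next
      case True
      then obtain j' r where act: "act R (Suc n) = Recv j' r" by blast
      then have "buffer r (st R (Suc n) i) (st R (Suc (Suc n)) i)"
        using step_of[OF who] step_Recv by simp
      then show ?thesis
      proof cases
        case (store Rivals)
        show ?thesis
        proof (cases "m \<in> Rivals")
          case True
          \<comment> \<open>The evicting message again equals \<open>m\<close>, so the eviction is
            undone by the insertion.\<close>
          then have rival: "same_type m r" "msg_signer m = msg_signer r" "v \<le> msg_view r"
            using store view by auto
          then obtain l' k1 where k1: "k1 < Suc n" "(l', r) \<in> sent R k1"
            using unforgeable[OF act self_part] signer unfolding sent_before_def by auto
          have "same_type r m" using rival(1) by (cases r; cases m) auto
          moreover have "tm R k1 < view_end" using tm_le[of k1 "Suc n"] k1 step.prems by simp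
          ultimately have "r = m" using rival_eq[OF sent view k1(2)] rival by simp
          then show ?thesis using store by simp
        qed (use IH store in auto)
      qed (use IH in auto)
    qed
  qed
qed

section \<open>States at a given time and progress by urgency\<close>

text \<open>
  Step \<open>K\<close> is the last one taken by time \<open>T\<close>, so \<open>st R (Suc K)\<close> is the state at time \<open>T\<close> in which no
  handler is pending.
\<close>

definition snapshot :: "time \<Rightarrow> nat \<Rightarrow> bool" where
  "snapshot T K \<longleftrightarrow> (\<forall>k. tm R k \<le> T \<longleftrightarrow> k \<le> K)"

lemma snapshot_exists:
  assumes "E_last R v \<le> T"
  shows "\<exists>K. snapshot T K"
proof -
  obtain e where "tm R e \<le> E_last R v" using entry[OF leader_correct] by blast
  then have "tm R e \<le> T" using assms by simp
  then show ?thesis using last_step_before unfolding snapshot_def by metis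
qed

lemma snapshot_curr_view:
  assumes i: "i \<in> correct R" and "snapshot T K" and T: "E_last R v \<le> T" "T < view_end"
  shows "curr_view (st R (Suc K) i) = v"
proof -
  obtain e where e: "who R e = i" "act R e = NewView v" "tm R e \<le> E_last R v"
    using entry[OF i] by blast
  have "e \<le> K" "tm R K < view_end" using assms(2) e(3) T unfolding snapshot_def by force+
  then show ?thesis using in_view[OF i e(1,2), of "Suc K" K] by simp
qed

text \<open>This is the source of all progress: the state after \<open>K\<close> persists from time
  \<open>T\<close> until the next step, so by \<open>urgent\<close> a handler enabled in it must
  have run already.\<close>

lemma snapshot_ran:
  assumes i: "i \<in> correct R" and "snapshot T K"
    and "step i (clock R i T) (st R (Suc K) i) (Run h) s' out d"
  shows "h \<in> ran (st R (Suc K) i)"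
proof -
  have "tm R K \<le> T" "T < tm R (Suc K)"
    using assms(2) unfolding snapshot_def by (simp, meson Suc_n_not_le_n not_le)
  then show ?thesis using urgent[OF i, of K T h] assms(3) unfolding pending_def by blast
qed

lemma snapshot_handler:
  assumes i: "i \<in> correct R" and "snapshot T K" and T: "E_last R v \<le> T" "T < view_end"
    and "h \<in> ran (st R (Suc K) i)"
  shows "\<exists>k\<le>K. who R k = i \<and> act R k = Run h \<and> curr_view (st R k i) = v \<and>
    curr_view (st R (Suc k) i) = v"
proof -
  obtain k where k: "k < Suc K" "who R k = i" "act R k = Run h" "curr_view (st R k i) = v"
    using handler_ran[OF i assms(5)] snapshot_curr_view[OF i assms(2) T] by metis
  then have "curr_view (st R (Suc k) i) = v" using step_curr_view[OF step_of[OF k(2)]] by simp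
  then show ?thesis using k less_Suc_eq_le by blast
qed

text \<open>A sender in view \<open>v\<close> entered it no earlier than \<open>GST\<close>, so
  \<open>delivery\<close> applies; \<open>received_kept\<close> then carries the message from its
  arrival to time \<open>T\<close>.\<close>

lemma snapshot_inbox:
  assumes "i \<in> correct R" and "(i, m) \<in> sent R k" and "msg_view m = v"
    and "tm R k + \<delta> \<le> T" and "T < view_end" and "snapshot T K"
  shows "m \<in> inbox (st R (Suc K) i)"
proof -
  \<comment> \<open>The state after the step matters here: a message sent on entry bears the new
    view, not the old one.\<close>
  have "curr_view (st R (Suc k) (who R k)) = v"
    using sent_signer_view[OF local_step assms(2)] assms(3) by simp
  then obtain e where "e < Suc k" "GST \<le> tm R e"
    using in_view_since_entry(2)[OF who_correct] by blast
  then have "GST \<le> tm R k" using tm_le[of e k] by simp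
  then obtain k' where k': "who R k' = i" "act R k' = Recv (who R k) m" "tm R k' \<le> tm R k + \<delta>"
    using delivery[OF assms(2,1)] by blast
  have "k' \<le> K" "tm R K < view_end" using k'(3) assms(4,5,6) unfolding snapshot_def by force+
  then show ?thesis using received_kept[OF assms(1,2,3) k'(1,2)] by simp
qed

section \<open>Proposal by the leader\<close>

lemma correct_quorum:
  obtains Q where "Q \<subseteq> correct R" and "quorum Q"
proof -
  obtain Q where "Q \<subseteq> correct R" "card Q = 2 * f + 1"
    using obtain_subset_with_card_n[OF card_correct] by metis
  then show thesis using that correct_procs unfolding quorum_def by blast
qed

text \<open>Here the proposal leaves at entry; the extra \<delta> only matches the bound for the
  other views.\<close>

lemma leader_entry_proposal:
  assumes "v = 1"
  shows "\<exists>k x M. who R k = leader v \<and> tm R k \<le> E_last R v + \<delta> \<and> safe_proposal v (Some x) M (leader v) \<and>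
    procs \<times> {MPropose v (Some x) M (leader v)} \<subseteq> sent R k"
proof -
  let ?l = "leader v"
  obtain e where e: "who R e = ?l" "act R e = NewView v" "tm R e \<le> E_last R v"
    using entry[OF leader_correct] by blast
  have "?l = leader 1" using assms by simp
  from step_NewView(4)[OF step_of[OF e(1), unfolded e(2)] assms this]
  have "procs \<times> {MPropose v (Some (myval ?l)) {} ?l} \<subseteq> sent R e" using assms by simp
  moreover have "safe_proposal v (Some (myval ?l)) {} ?l"
    using myval_valid[OF leader_correct] assms unfolding safe_proposal_def by blast
  moreover have "tm R e \<le> E_last R v + \<delta>" using e(3) delta_nonneg by simp
  ultimately show ?thesis using e(1) by blast
qed

lemma leader_received_quorum:
  assumes "v \<noteq> 1" and "snapshot T K" and T: "E_last R v + \<delta> \<le> T" "T < view_end"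
  shows "\<exists>M. newleader_quorum v M \<and> MNewLeader ` M \<subseteq> inbox (st R (Suc K) (leader v))"
proof -
  have "\<exists>m. nl_view m = v \<and> nl_signer m = j \<and> valid_newleader m \<and>
      MNewLeader m \<in> inbox (st R (Suc K) (leader v))" if j: "j \<in> correct R" for j
  proof -
    obtain e where e: "who R e = j" "act R e = NewView v" "tm R e \<le> E_last R v"
      using entry[OF j] by blast
    let ?s = "st R e j"
    let ?m = "NewLeader v (locked_view ?s) (prepared_val ?s) (cert ?s) (pre_view ?s) (curr_val ?s) j"
    have sent: "(leader v, MNewLeader ?m) \<in> sent R e"
      by (rule step_NewView(3)[OF step_of[OF e(1), unfolded e(2)] assms(1)])
    have "MNewLeader ?m \<in> inbox (st R (Suc K) (leader v))"
      by (rule snapshot_inbox[OF leader_correct sent _ _ T(2) assms(2)]) (use e(3) T(1) in simp_all)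
    moreover have "valid_newleader ?m" by (rule sent_newleader_valid(1)[OF sent])
    ultimately show ?thesis by (intro exI[of _ ?m]) simp
  qed
  then obtain n where n: "nl_view (n j) = v" "nl_signer (n j) = j" "valid_newleader (n j)"
      "MNewLeader (n j) \<in> inbox (st R (Suc K) (leader v))" if "j \<in> correct R" for j
    by metis
  obtain Q where Q: "Q \<subseteq> correct R" "quorum Q" using correct_quorum by blast
  \<comment> \<open>The choice function \<open>n\<close> is a right inverse of
    \<open>nl_signer\<close> on \<open>Q\<close>, which yields the required bijection.\<close>
  have "nl_signer (n j) = j" if "j \<in> Q" for j using n(2) Q(1) that by blast
  then have "bij_betw nl_signer (n ` Q) Q" by (simp add: bij_betw_def inj_on_def image_image)
  then have "newleader_quorum v (n ` Q)" using n Q unfolding newleader_quorum_def by blast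
  moreover have "MNewLeader ` n ` Q \<subseteq> inbox (st R (Suc K) (leader v))" using n(4) Q(1) by blast
  ultimately show ?thesis by blast
qed

lemma leader_proposal:
  "\<exists>k x M. who R k = leader v \<and> tm R k \<le> E_last R v + \<delta> \<and> safe_proposal v (Some x) M (leader v) \<and>
    procs \<times> {MPropose v (Some x) M (leader v)} \<subseteq> sent R k"
proof (cases "v = 1")
  case True
  then show ?thesis by (rule leader_entry_proposal)
next
  case v1: False
  let ?l = "leader v" and ?T = "E_last R v + \<delta>"
  have T: "E_last R v \<le> ?T" "?T < view_end"
    using delta_nonneg Ff_v deadline_before_view_end by linarith+
  obtain K where K: "snapshot ?T K" using snapshot_exists[OF T(1)] by blast
  have "HPropose \<in> ran (st R (Suc K) ?l)"
  proof (rule ccontr)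
    let ?s = "st R (Suc K) ?l"
    assume "HPropose \<notin> ran ?s"
    obtain M where M: "newleader_quorum v M" "MNewLeader ` M \<subseteq> inbox ?s"
      using leader_received_quorum[OF v1 K order_refl T(2)] by blast
    obtain xs vs where slow: "slow_choice M xs vs"
      using slow_choice_total newleader_quorum_finite[OF M(1)] by blast
    obtain xf vf where fast: "fast_choice M = (xf, vf)" by fastforce
    note propose = step.propose[OF snapshot_curr_view[OF leader_correct K T] refl v1
        \<open>HPropose \<notin> ran ?s\<close> M(2,1) slow fast refl]
    show False using snapshot_ran[OF leader_correct K propose] \<open>HPropose \<notin> ran ?s\<close> by simp
  qed
  then obtain k where k: "k \<le> K" "who R k = ?l" "act R k = Run HPropose" "curr_view (st R k ?l) = v"
    using snapshot_handler[OF leader_correct K T] by blast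
  have tm: "tm R k \<le> ?T" using K k(1) unfolding snapshot_def by blast
  \<comment> \<open>The run may have used a different message set from the one exhibited above, so
    safety is checked for the set and choices of this very step.\<close>
  from step_of[OF k(2), unfolded k(3)] show ?thesis
  proof cases
    case (propose w M xs vs xf vf x)
    obtain y where y: "x = Some y" "valid y"
      using proposed_value_valid[OF leader_correct propose(8-11)] propose(12) by blast
    have "newleader_quorum v M" using propose(4,9) k(4) by simp
    moreover have "(vs \<ge> vf \<and> vs > 0 \<longrightarrow> x = xs) \<and> (vs < vf \<longrightarrow> x = xf)" using propose(12) by simp
    ultimately have "safe_proposal v (Some y) M ?l"
      using propose(10,11) y unfolding safe_proposal_def by blast
    moreover have "procs \<times> {MPropose v (Some y) M ?l} \<subseteq> sent R k"
      using propose(2,4) k(4) y(1) by simp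
    ultimately show ?thesis using k(2) tm by blast
  qed
qed

section \<open>Acceptance, locking and decision\<close>

definition accepts :: "nat \<Rightarrow> proc \<Rightarrow> 'v \<Rightarrow> bool" where
  "accepts k i x \<longleftrightarrow> who R k = i \<and> curr_view (st R (Suc k) i) = v \<and>
     curr_val (st R (Suc k) i) = Some x \<and> voted (st R (Suc k) i) = Some True \<and>
     timer (st R (Suc k) i) = Some (clock R i (tm R k) + Ff v) \<and>
     sent R k = procs \<times> {MPrepared (Prepared v (hash x) i)}"

text \<open>One value serves all processes because the correct leader sends a single proposal in
  \<open>v\<close>. The bound \<open>GST\<close> is recorded so that the timer started here can
  later be measured in real time.\<close>

lemma all_accept:
  "\<exists>x. \<forall>i\<in>correct R. \<exists>k. accepts k i x \<and> GST \<le> tm R k \<and> tm R k \<le> E_last R v + 2 * \<delta>"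
proof -
  let ?l = "leader v" and ?T = "E_last R v + 2 * \<delta>"
  obtain k0 x M where k0: "who R k0 = ?l" "tm R k0 \<le> E_last R v + \<delta>"
    and safe: "safe_proposal v (Some x) M ?l"
    and proposed: "procs \<times> {MPropose v (Some x) M ?l} \<subseteq> sent R k0"
    using leader_proposal by blast
  have T: "E_last R v \<le> ?T" "?T < view_end"
    using delta_nonneg Ff_v deadline_before_view_end by linarith+
  obtain K where K: "snapshot ?T K" using snapshot_exists[OF T(1)] by blast
  have "\<exists>k. accepts k i x \<and> GST \<le> tm R k \<and> tm R k \<le> ?T" if i: "i \<in> correct R" for i
  proof -
    let ?s = "st R (Suc K) i"
    have "(i, MPropose v (Some x) M ?l) \<in> sent R k0" using proposed i correct_procs by blast
    then have inbox: "MPropose v (Some x) M ?l \<in> inbox ?s"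
      by (rule snapshot_inbox[OF i _ _ _ T(2) K]) (use k0(2) in simp_all)
    note view = snapshot_curr_view[OF i K T]
    have "HAccept \<in> ran ?s"
    proof (rule ccontr)
      assume new: "HAccept \<notin> ran ?s"
      then have "voted ?s = Some False"
        using invariant[OF i, of "Suc K"] view v_pos unfolding state_inv_def by auto
      note accept = step.accept[OF inbox view this safe refl]
      show False using snapshot_ran[OF i K accept] new by simp
    qed
    then obtain k where k: "k \<le> K" "who R k = i" "act R k = Run HAccept"
        "curr_view (st R k i) = v" "curr_view (st R (Suc k) i) = v"
      using snapshot_handler[OF i K T] by blast
    from step_Accept[OF step_of[OF k(2), unfolded k(3)], unfolded k(4)] obtain M' y
      where y: "MPropose v (Some y) M' ?l \<in> inbox (st R k i)" "curr_val (st R (Suc k) i) = Some y"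
        "voted (st R (Suc k) i) = Some True" "timer (st R (Suc k) i) = Some (clock R i (tm R k) + Ff v)"
        "sent R k = procs \<times> {MPrepared (Prepared v (hash y) i)}" by blast
    \<comment> \<open>The accepted proposal is not yet known to be the one delivered above, but it
      bears the leader's signature, so uniqueness identifies them.\<close>
    obtain l k1 where "who R k1 = ?l" "(l, MPropose v (Some y) M' ?l) \<in> sent R k1"
      using inbox_parts_sent[OF i y(1) self_part] leader_correct unfolding sent_before_def by auto
    moreover have "(i, MPropose v (Some x) M ?l) \<in> sent R k0" using proposed i correct_procs by blast
    ultimately have "MPropose v (Some y) M' ?l = MPropose v (Some x) M ?l"
      by (intro sent_unique) (use k0(1) in simp_all)
    then have "accepts k i x" unfolding accepts_def using k y by simp
    moreover obtain e where "e < k" "GST \<le> tm R e" using in_view_since_entry(2)[OF i k(4)] by blast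
    moreover have "tm R k \<le> ?T" using K k(1) unfolding snapshot_def by blast
    ultimately show ?thesis using tm_le[of e k] by force
  qed
  then show ?thesis by blast
qed

text \<open>\<open>HLock\<close> in \<open>ran\<close> stands in for the locked view: membership
  persists within a view by \<open>same_view\<close>, and \<open>state_inv\<close> then gives
  \<open>locked_view\<close>.\<close>

definition locks :: "nat \<Rightarrow> proc \<Rightarrow> 'v \<Rightarrow> bool" where
  "locks k i x \<longleftrightarrow> who R k = i \<and> curr_view (st R k i) = v \<and> curr_view (st R (Suc k) i) = v \<and>
     voted (st R k i) = Some True \<and> curr_val (st R k i) = Some x \<and> HLock \<in> ran (st R (Suc k) i) \<and>
     sent R k = procs \<times> {MCommitted v (hash x) i}"

text \<open>Acceptance happens by \<open>E_last R v + 2 * \<delta>\<close>, so at the stated time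
  every timer has expired and, since \<delta> is at most \<open>Ff v\<close>, all
  \<open>PREPARED\<close> messages of correct processes have arrived.\<close>

lemma all_lock:
  "\<exists>x. \<forall>i\<in>correct R. \<exists>k. locks k i x \<and> tm R k \<le> E_last R v + Ff v + 2 * \<delta>"
proof -
  let ?T = "E_last R v + Ff v + 2 * \<delta>"
  obtain x where acc: "\<And>i. i \<in> correct R \<Longrightarrow>
      \<exists>k. accepts k i x \<and> GST \<le> tm R k \<and> tm R k \<le> E_last R v + 2 * \<delta>"
    using all_accept by blast
  have T: "E_last R v \<le> ?T" "?T < view_end" and Ff: "\<delta> \<le> Ff v" "0 \<le> Ff v"
    using delta_nonneg Ff_v deadline_before_view_end by linarith+
  obtain K where K: "snapshot ?T K" using snapshot_exists[OF T(1)] by blast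
  have "\<exists>k. locks k i x \<and> tm R k \<le> ?T" if i: "i \<in> correct R" for i
  proof -
    \<comment> \<open>The witness certificate is signed by all correct processes; there may be more
      than \<open>2 * f + 1\<close> of them, which \<open>prepared\<close> admits.\<close>
    let ?s = "st R (Suc K) i" and ?C = "{Prepared v (hash x) j | j. j \<in> correct R}"
    note view = snapshot_curr_view[OF i K T]
    obtain k where k: "accepts k i x" "GST \<le> tm R k" "tm R k \<le> E_last R v + 2 * \<delta>"
      using acc[OF i] by blast
    have "tm R k \<le> ?T" using k(3) Ff by simp
    then have le: "Suc k \<le> Suc K" using K unfolding snapshot_def by simp
    have s: "voted ?s = Some True" "curr_val ?s = Some x"
        "timer ?s = Some (clock R i (tm R k) + Ff v)"
      using same_view(2)[OF i le] k(1) view unfolding accepts_def by auto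
    \<comment> \<open>From acceptance on the local clock advances like real time, and at least
      \<open>Ff v\<close> passes until \<open>?T\<close>.\<close>
    have expired: "clock R i (tm R k) + Ff v \<le> clock R i ?T"
      using clock_no_drift[OF i k(2) \<open>tm R k \<le> ?T\<close>] k(3) by simp
    have "MPrepared (Prepared v (hash x) j) \<in> inbox ?s" if j: "j \<in> correct R" for j
    proof -
      obtain k' where k': "accepts k' j x" "tm R k' \<le> E_last R v + 2 * \<delta>" using acc[OF j] by blast
      have "(i, MPrepared (Prepared v (hash x) j)) \<in> sent R k'"
        using k'(1) i correct_procs unfolding accepts_def by auto
      then show ?thesis
        by (rule snapshot_inbox[OF i _ _ _ T(2) K]) (use k'(2) Ff in simp_all)
    qed
    then have inbox: "MPrepared ` ?C \<subseteq> inbox ?s" by blast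
    have "prepared ?C v (hash x)"
      unfolding prepared_def using correct_procs card_correct by blast
    note lock = step.lock[OF s(3) expired view s(1,2) inbox this]
    obtain k' where k': "k' \<le> K" "who R k' = i" "act R k' = Run HLock"
        "curr_view (st R k' i) = v" "curr_view (st R (Suc k') i) = v"
      using snapshot_handler[OF i K T snapshot_ran[OF i K lock]] by blast
    note step = step_of[OF k'(2), unfolded k'(3)]
    obtain y where y: "voted (st R k' i) = Some True" "curr_val (st R k' i) = Some y"
        "sent R k' = procs \<times> {MCommitted v (hash y) i}"
      using step_Lock[OF step] k'(4) by auto
    have "curr_val ?s = curr_val (st R k' i)"
      using same_view(2)[OF i, of k' "Suc K"] k' view y(1) by simp
    then have "locks k' i x"
      unfolding locks_def using k' y s(2) step_ran(3)[OF step] by simp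
    moreover have "tm R k' \<le> ?T" using K k'(1) unfolding snapshot_def by blast
    ultimately show ?thesis by blast
  qed
  then show ?thesis by blast
qed

text \<open>The decision is reached on the slow path: the correct processes alone supply a quorum of
  \<open>COMMITTED\<close> messages for the common value, one message delay after the last of them
  has locked.\<close>

lemma all_decide:
  assumes i: "i \<in> correct R"
  shows "\<exists>t. decides_at R i v t \<and> t \<le> E_last R v + Ff v + 3 * \<delta>"
proof -
  let ?T = "E_last R v + Ff v + 3 * \<delta>"
  obtain x where lock: "\<And>i. i \<in> correct R \<Longrightarrow>
      \<exists>k. locks k i x \<and> tm R k \<le> E_last R v + Ff v + 2 * \<delta>"
    using all_lock by blast
  have T: "E_last R v \<le> ?T" "?T < view_end"
    using delta_nonneg Ff_v deadline_before_view_end by linarith+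
  obtain K where K: "snapshot ?T K" using snapshot_exists[OF T(1)] by blast
  let ?s = "st R (Suc K) i"
  note view = snapshot_curr_view[OF i K T]
  obtain k where k: "locks k i x" "tm R k \<le> E_last R v + Ff v + 2 * \<delta>" using lock[OF i] by blast
  have "tm R k \<le> ?T" using k(2) delta_nonneg by simp
  then have le: "k \<le> K" using K unfolding snapshot_def by simp
  have val: "curr_val ?s = Some x"
    using same_view(2)[OF i, of k "Suc K"] le k(1) view unfolding locks_def by simp
  have "HLock \<in> ran ?s"
    using same_view(1)[OF i, of "Suc k" "Suc K"] le k(1) view unfolding locks_def by auto
  then have locked: "locked_view ?s = v"
    using invariant[OF i, of "Suc K"] view unfolding state_inv_def by simp
  have committed: "MCommitted v (hash x) j \<in> inbox ?s" if j: "j \<in> correct R" for j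
  proof -
    obtain k' where k': "locks k' j x" "tm R k' \<le> E_last R v + Ff v + 2 * \<delta>" using lock[OF j] by blast
    have "(i, MCommitted v (hash x) j) \<in> sent R k'"
      using k'(1) i correct_procs unfolding locks_def by auto
    then show ?thesis by (rule snapshot_inbox[OF i _ _ _ T(2) K]) (use k'(2) in simp_all)
  qed
  obtain Q where Q: "Q \<subseteq> correct R" "quorum Q" using correct_quorum by blast
  have "\<forall>j\<in>Q. MCommitted v (hash x) j \<in> inbox ?s" using committed Q(1) by blast
  note decide = step.decide[OF view locked val Q(2) this]
  obtain k' where k': "k' \<le> K" "who R k' = i" "act R k' = Run HDecide" "curr_view (st R k' i) = v"
    using snapshot_handler[OF i K T snapshot_ran[OF i K decide]] by blast
  then have "decides_at R i v (tm R k')"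
    using step_decision[OF step_of[OF k'(2), unfolded k'(3)]] unfolding decides_at_def by blast
  moreover have "tm R k' \<le> ?T" using K k'(1) unfolding snapshot_def by blast
  ultimately show ?thesis by blast
qed

end

theorem theorem62:
  fixes f :: nat
    and valid :: "'v \<Rightarrow> bool"
    and hash :: "'v \<Rightarrow> 'h"
    and myval :: "proc \<Rightarrow> 'v"
    and F Ff :: "view \<Rightarrow> time"
    and GST \<delta> :: time
    and R :: "('v, 'h) execution"
    and \<V> v :: view
  assumes "sbft_execution f valid hash myval Ff GST \<delta> R"
    and "timeout_function F"
    and "synchronizer GST (2 * \<delta>) F \<V> R"
    and "v \<ge> \<V>"
    and "Ff v > 2 * \<delta>"
    and "F v - Ff v > 5 * \<delta>"
    and "sbft.leader f v \<in> correct R"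
  shows "\<forall>i\<in>correct R. \<exists>t. decides_at R i v t \<and> t \<le> E_last R v + Ff v + 3 * \<delta>"
proof -
  interpret sbft_execution f valid hash myval Ff GST \<delta> R by fact
  interpret synchronizer GST "2 * \<delta>" F \<V> R by fact
  interpret sbft_good_view f valid hash myval F Ff GST \<delta> R \<V> v
    using assms by unfold_locales auto
  show ?thesis using all_decide by blast
qed

end
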